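(* Let $k$ be a finite field, and let $\epsilon:\mathbb{P}^3(k)\to K(4)$ be a surjective morphism. Let $A,B,C,D$ denote the preimages under $\epsilon$ of the four vertices of $K(4)$ (sets of points of $\mathbb{P}^3(k)$ partitioning its point set). Then, up to a permutation of $A,B,C,D$, the $\mathbb{F}_1$-structure endowed by $\epsilon$ on $\mathbb{P}^3(k)$ is described as follows. There is a line $U$ of $\mathbb{P}^3(k)$ such that $|U\cap A|\geq 1$, $|U\cap B|\geq 1$ and $U\subseteq A\cup B$, and one of the following two cases holds. (E) There is one plane $\Pi_C$ of Type II containing $U$, and its unique point not in $A\cup B$ is contained in $C$; for any other plane $\Pi$ containing $U$, all points of $\Pi\setminus U$ are contained in $D$. (F) There is a line $\widehat{U}$ with $|C\cap\widehat{U}|\geq 1$, $|D\cap\widehat{U}|\geq 1$ and $C\cup D=\widehat{U}$; each point $u$ which is incident with neither $U$ nor $\widehat{U}$ is incident with a unique line $W$ which meets both $U$ and $\widehat{U}$, and if $W\cap U$ is a point of $A$, respectively of $B$, then all points of $W\setminus (W\cap\widehat{U})$ are points of $A$, respectively of $B$.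
   Context: $\mathbb{P}^3(k)$ is the $3$-dimensional projective space over $k$, viewed as an incidence geometry with its $k$-rational points and lines; lines and planes are identified with their sets of points. $K(4)$ is the complete graph on $4$ vertices, viewed as the incidence geometry whose points are the vertices and whose lines are the edges (each line has exactly two points). A morphism maps points to points and lines to lines and preserves incidence; it is surjective (an epimorphism) if it is surjective on points and on lines. Such a surjective morphism is said to endow $\mathbb{P}^3(k)$ with an $\mathbb{F}_1$-structure. Type II: a plane $\Pi_C$ containing $U$, whose unique point not in $A\cup B$ is a point $c\in C$, is of Type II if the set of lines of $\Pi_C$ through $c$ is partitioned into two sets $\widehat{A}$ and $\widehat{B}$ with $|\widehat{A}|\geq 2$ and $|\widehat{B}|\geq 2$, such that the points of $A$ in $\Pi_C$ are exactly the points different from $c$ incident with the lines of $\widehat{A}$, and the points of $B$ in $\Pi_C$ are exactly the points different from $c$ incident with the lines of $\widehat{B}$. *)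

theory Defs
  imports "HOL-Analysis.Cartesian_Space"
begin

text \<open>A geometry is given by its set of points and its set of lines, every line being identified
  with the set of points incident with it, so that incidence is membership. A morphism is a pair of
  maps; their values outside the geometry are irrelevant.\<close>

definition geometry_morphism ::
    "'a set \<Rightarrow> 'a set set \<Rightarrow> 'b set \<Rightarrow> 'b set set \<Rightarrow> ('a \<Rightarrow> 'b) \<Rightarrow> ('a set \<Rightarrow> 'b set) \<Rightarrow> bool" where
  "geometry_morphism P L P' L' f g \<longleftrightarrow>
     f ` P \<subseteq> P' \<and> g ` L \<subseteq> L' \<and> (\<forall>p\<in>P. \<forall>l\<in>L. p \<in> l \<longrightarrow> f p \<in> g l)"

definition geometry_epimorphism ::
    "'a set \<Rightarrow> 'a set set \<Rightarrow> 'b set \<Rightarrow> 'b set set \<Rightarrow> ('a \<Rightarrow> 'b) \<Rightarrow> ('a set \<Rightarrow> 'b set) \<Rightarrow> bool" where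
  "geometry_epimorphism P L P' L' f g \<longleftrightarrow>
     geometry_morphism P L P' L' f g \<and> f ` P = P' \<and> g ` L = L'"

definition pg_points :: "('k::field ^ 4) set set" where
  "pg_points = {p. vec.subspace p \<and> vec.dim p = 1}"

definition pg_lines :: "('k::field ^ 4) set set set" where
  "pg_lines = {{p \<in> pg_points. p \<subseteq> V} | V. vec.subspace V \<and> vec.dim V = 2}"

definition pg_planes :: "('k::field ^ 4) set set set" where
  "pg_planes = {{p \<in> pg_points. p \<subseteq> V} | V. vec.subspace V \<and> vec.dim V = 3}"

text \<open>The vertices are the elements of the four-element type \<open>4\<close>, an edge is the set of its two
  end points.\<close>

definition K4_points :: "4 set" where
  "K4_points = UNIV"

definition K4_lines :: "4 set set" where
  "K4_lines = {e. e \<subseteq> K4_points \<and> card e = 2}"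

definition point_fibre :: "(('k::field ^ 4) set \<Rightarrow> 4) \<Rightarrow> 4 \<Rightarrow> ('k ^ 4) set set" where
  "point_fibre f v = {p \<in> pg_points. f p = v}"

text \<open>The condition that \<open>P\<close> contains the line \<open>U\<close> is not part of this predicate. The sets \<open>Ah\<close> and \<open>Bh\<close> are the two classes of lines of \<open>P\<close> through \<open>c\<close>.\<close>

definition type_II_plane ::
    "('k::field ^ 4) set set \<Rightarrow> ('k ^ 4) set set \<Rightarrow> ('k ^ 4) set set \<Rightarrow> ('k ^ 4) set set \<Rightarrow> bool" where
  "type_II_plane A B C P \<longleftrightarrow> P \<in> pg_planes \<and>
     (\<exists>c\<in>C. P - (A \<union> B) = {c} \<and>
       (\<exists>Ah Bh. Ah \<union> Bh = {l \<in> pg_lines. l \<subseteq> P \<and> c \<in> l} \<and> Ah \<inter> Bh = {} \<and>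
          card Ah \<ge> 2 \<and> card Bh \<ge> 2 \<and>
          A \<inter> P = \<Union>Ah - {c} \<and> B \<inter> P = \<Union>Bh - {c}))"

end

theory Submission
  imports Defs
begin

text \<open>Write A, B, C, D for the four colour classes. An edge of \<open>K(4)\<close> has two end points, so no line
  carries three colours, and this is all that the proof uses besides the fact that all four colours
  occur. Choose a vector \<open>e i\<close> of each colour. A combination of some of these vectors always has one
  of their colours (\<open>colour_in_span\<close>), so the four vectors form a basis, and the points
  are organised around a tetrahedron with differently coloured vertices.

  Say that i beats j if the edge through \<open>e i\<close> and \<open>e j\<close> has colour i except at \<open>e j\<close>. If every
  colour in S beats every colour in T, then adding a combination of the \<open>e j\<close> with \<open>j \<in> T\<close> does
  not change the colour of a nonzero combination of the \<open>e i\<close> with \<open>i \<in> S\<close>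
  (\<open>colour_dominated_add\<close>). So where one end of an edge beats the other, the colouring propagates
  from the edges to the whole space.

  The heart of the matter is that few edges can be neutral, that is, won by neither end. The
  points other than \<open>e i\<close> of colour i on the edge from i to j correspond to a subset of the
  multiplicative group of the field, and the
  subsets belonging to the three edges of a face are multiplicatively related, because the point
  inside the face is seen from all three vertices (\<open>side_colours_multiply\<close>). In a finite
  group this forces one of the subsets to be empty or full (\<open>product_closed_imp_trivial\<close>), and then
  two edges of the face are won, both by or both against their common vertex
  (\<open>rainbow_triangle\<close>). Over a field with a nontrivial valuation there are further colourings; the
  counting argument is what excludes them.

  Combinatorics on four vertices leaves two patterns (\<open>four_vertex_tournament\<close>). Either two colours
  a, b both beat the two others; then C and D fill the line through \<open>e c\<close> and \<open>e d\<close>, and the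
  colour of any other point is that of its projection from this line to the opposite edge, which is
  (F). Or the edge between a and b is neutral, both a and b beat c, and d beats all others; then
  every point outside the plane of \<open>e a\<close>, \<open>e b\<close>, \<open>e c\<close> has colour d, and that plane is the cone
  with vertex \<open>e c\<close> over the edge between a and b, hence of Type II, which is (E). The classes of
  lines in Type II have at least two members because the edge is neutral.\<close>

section \<open>A product lemma for subsets of a finite field\<close>

lemma times_image_nonzero:
  fixes g :: "'k::field"
  assumes "g \<noteq> 0"
  shows "(*) g ` (- {0}) = - {0}"
proof (intro equalityI subsetI)
  fix x :: 'k assume "x \<in> - {0}"
  then show "x \<in> (*) g ` (- {0})"
    using assms by (intro image_eqI[of _ _ "x / g"]) auto
qed (use assms in auto)

text \<open>Suppose that P, Q and their complements are nonempty. Multiplication by a nonzero scalar is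
  injective, so the two closure conditions force P, Q and R to be equally large. Then every
  \<open>g \<noteq> 0\<close> satisfies \<open>g Q = R\<close>: for \<open>g \<in> P\<close> directly, and for \<open>g \<notin> P\<close> because \<open>g\<close> maps the
  complement of Q onto that of R. So Q is invariant under the multiplicative group, which acts
  transitively on the nonzero elements.\<close>

lemma product_closed_imp_trivial:
  fixes P Q R :: "'k::{field,finite} set"
  assumes sub: "P \<subseteq> - {0}" "Q \<subseteq> - {0}" "R \<subseteq> - {0}"
    and closed: "\<And>p q. p \<in> P \<Longrightarrow> q \<in> Q \<Longrightarrow> p * q \<in> R"
    and coclosed: "\<And>p q. p \<in> - {0} - P \<Longrightarrow> q \<in> - {0} - Q \<Longrightarrow> p * q \<in> - {0} - R"
  shows "P = {} \<or> P = - {0} \<or> Q = {} \<or> Q = - {0}"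
proof (rule ccontr)
  assume nontrivial: "\<not> ?thesis"
  define P' Q' R' where "P' = - {0} - P" and "Q' = - {0} - Q" and "R' = - {0} - R"
  obtain p q p' q' where pq: "p \<in> P" "q \<in> Q" "p' \<in> P'" "q' \<in> Q'"
    using nontrivial sub unfolding P'_def Q'_def by blast
  then have nz: "p \<noteq> 0" "q \<noteq> 0" "p' \<noteq> 0" "q' \<noteq> 0"
    using sub unfolding P'_def Q'_def by auto
  have card_times: "card ((*) g ` S) = card S" if "g \<noteq> 0" for g and S :: "'k set"
    using that by (intro card_image) (auto intro: inj_onI)
  have card_compl: "card S' = card (- {0::'k}) - card S"
    if "S \<subseteq> - {0}" "S' = - {0} - S" for S S' :: "'k set"
    using that by (simp add: card_Diff_subset finite_subset)
  have card_le: "card S \<le> card (- {0::'k})" if "S \<subseteq> - {0}" for S :: "'k set"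
    using that by (intro card_mono) auto
  have "card ((*) p ` Q) \<le> card R" "card ((*) p' ` Q') \<le> card R'"
    "card ((*) q ` P) \<le> card R" "card ((*) q' ` P') \<le> card R'"
    using closed coclosed pq
    by (auto intro!: card_mono simp: P'_def Q'_def R'_def mult.commute[of q] mult.commute[of q'])
  then have le: "card Q \<le> card R" "card Q' \<le> card R'" "card P \<le> card R" "card P' \<le> card R'"
    using card_times nz by auto
  have eq: "card Q = card R"
    using le card_compl[OF sub(2) Q'_def] card_compl[OF sub(3) R'_def] card_le[OF sub(2)]
      card_le[OF sub(3)] by linarith
  then have eq': "card Q' = card R'"
    using card_compl[OF sub(2) Q'_def] card_compl[OF sub(3) R'_def] by simp
  have translate: "(*) g ` Q = R" if g: "g \<noteq> 0" for g
  proof (cases "g \<in> P")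
    case True
    then show ?thesis
      using closed card_times[OF g] eq by (intro card_subset_eq) auto
  next
    case False
    then have "(*) g ` Q' = R'"
      using coclosed card_times[OF g] eq' g
      by (intro card_subset_eq) (auto simp: P'_def Q'_def R'_def)
    moreover have "(*) g ` (- {0} - S) = - {0} - (*) g ` S" for S :: "'k set"
      using times_image_nonzero[OF g] g by (subst image_set_diff) (auto intro: injI)
    ultimately have "- {0} - (*) g ` Q = - {0} - R"
      unfolding Q'_def R'_def by simp
    moreover have "(*) g ` Q \<subseteq> - {0}"
      using g sub(2) by auto
    ultimately show ?thesis
      using sub(3) by blast
  qed
  have "R = Q"
    using translate[of 1] by simp
  moreover have "q' \<in> (*) (q' / q) ` Q"
    using pq(2) nz by (auto simp: image_iff intro!: bexI[of _ q])
  ultimately have "q' \<in> Q"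
    using translate[of "q' / q"] nz by simp
  then show False
    using pq(4) unfolding Q'_def by simp
qed

section \<open>Colourings of a vector space without three-coloured lines\<close>

text \<open>A colouring of the points of a projective space is carried by a colouring of the nonzero
  vectors that is constant on one-dimensional subspaces; the value at 0 is irrelevant. That no line
  carries three colours is expressed by the colour of a sum of two differently coloured vectors.\<close>

locale rainbow_free_frame =
  fixes \<phi> :: "'k::{field,finite} ^ 'n \<Rightarrow> 'c::finite" and e :: "'c \<Rightarrow> 'k ^ 'n"
  assumes colour_scale: "s \<noteq> 0 \<Longrightarrow> x \<noteq> 0 \<Longrightarrow> \<phi> (s *s x) = \<phi> x"
    and colour_add: "x \<noteq> 0 \<Longrightarrow> y \<noteq> 0 \<Longrightarrow> \<phi> x \<noteq> \<phi> y \<Longrightarrow> x + y \<noteq> 0 \<Longrightarrow>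
      \<phi> (x + y) = \<phi> x \<or> \<phi> (x + y) = \<phi> y"
    and frame_nonzero: "e i \<noteq> 0"
    and colour_frame: "\<phi> (e i) = i"
begin

lemma colour_scaled_frame: "s \<noteq> 0 \<Longrightarrow> \<phi> (s *s e i) = i"
  using colour_scale[OF _ frame_nonzero] colour_frame by simp

lemma inj_frame: "inj e"
  using colour_frame by (metis injI)

lemma frame_image_diff: "e ` (S - {j}) = e ` S - {e j}"
  using inj_frame by (auto simp: inj_def)

lemma add_nonzero_if_colours_differ:
  assumes "x \<noteq> 0" "\<phi> x \<noteq> \<phi> y"
  shows "x + y \<noteq> 0"
proof
  assume "x + y = 0"
  then have "y = (- 1) *s x"
    by (simp add: eq_neg_iff_add_eq_0 add.commute)
  then show False
    using assms colour_scale[of "- 1" x] by simp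
qed

text \<open>By induction on S: adding a multiple of a further frame vector \<open>e i\<close> to a vector with a colour
  in S yields i or that colour.\<close>

lemma colour_in_span:
  assumes "x \<in> vec.span (e ` S)" "x \<noteq> 0"
  shows "\<phi> x \<in> S"
  using finite[of S] assms
proof (induction S arbitrary: x)
  case empty
  then show ?case by simp
next
  case (insert i S)
  then obtain s where s: "x - s *s e i \<in> vec.span (e ` S)"
    by (auto simp: vec.span_breakdown_eq)
  define y where "y = x - s *s e i"
  have x: "x = s *s e i + y"
    unfolding y_def by simp
  show ?case
  proof (cases "s = 0 \<or> y = 0")
    case True
    then show ?thesis
      using insert.IH[of y] insert.prems s x colour_scaled_frame[of s i] unfolding y_def by auto
  next
    case False
    then have "\<phi> y \<in> S" "s *s e i \<noteq> 0" "\<phi> (s *s e i) \<noteq> \<phi> y"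
      using insert.IH[of y] insert.hyps(2) s frame_nonzero colour_scaled_frame
      unfolding y_def by auto
    then show ?thesis
      using colour_add[of "s *s e i" y] False insert.prems(2) x colour_scaled_frame by auto
  qed
qed

lemma frame_split:
  assumes "x \<in> vec.span (e ` S)" "j \<in> S"
  obtains s y where "x = s *s e j + y" "y \<in> vec.span (e ` (S - {j}))"
proof -
  obtain s where "x - s *s e j \<in> vec.span (e ` S - {e j})"
    using vec.span_breakdown assms by blast
  then show ?thesis
    using that[of s "x - s *s e j"] by (simp add: frame_image_diff)
qed

lemma independent_frame: "vec.independent (e ` S)"
proof
  assume "vec.dependent (e ` S)"
  then obtain i where "i \<in> S" "e i \<in> vec.span (e ` (S - {i}))"
    unfolding vec.dependent_def by (auto simp: frame_image_diff)
  then show False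
    using colour_in_span[OF _ frame_nonzero] colour_frame by fastforce
qed

lemma dim_span_frame: "vec.dim (vec.span (e ` S)) = card S"
  using vec.dim_span_eq_card_independent[OF independent_frame]
    card_image[OF inj_on_subset[OF inj_frame]] by simp

lemma eq_zero_if_in_complementary_spans:
  assumes "x \<in> vec.span (e ` S)" "x \<in> vec.span (e ` T)" "S \<inter> T = {}"
  shows "x = 0"
  using colour_in_span assms by blast

text \<open>Components of other colours may be dropped: the sum \<open>x + y\<close> has the colour of x or of y,
  and these lie in the disjoint sets S and T.\<close>

lemma colour_restrict:
  assumes "x \<in> vec.span (e ` S)" "y \<in> vec.span (e ` T)" "S \<inter> T = {}"
    and "x + y \<noteq> 0" "\<phi> (x + y) \<in> S"
  shows "x \<noteq> 0" "\<phi> x = \<phi> (x + y)"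
proof -
  have y: "y = 0 \<or> \<phi> y \<in> T"
    using colour_in_span assms(2) by blast
  then show x: "x \<noteq> 0"
    using assms(3-5) by auto
  show "\<phi> x = \<phi> (x + y)"
    using y colour_in_span[OF assms(1) x] colour_add[OF x _ _ assms(4)] assms(3,5)
    by (cases "y = 0", simp, metis disjoint_iff)
qed

text \<open>\<open>beats i j\<close>: on the line through \<open>e i\<close> and \<open>e j\<close>, the point \<open>e j\<close> is the only one that
  does not have colour i.\<close>

definition beats :: "'c \<Rightarrow> 'c \<Rightarrow> bool" where
  "beats i j \<longleftrightarrow> (\<forall>t. t \<noteq> 0 \<longrightarrow> \<phi> (e i + t *s e j) = i)"

lemma scaled_pair_colour:
  assumes "s \<noteq> 0"
  shows "\<phi> (s *s e i + t *s e j) = \<phi> (e i + (t / s) *s e j)"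
proof (cases "e i + (t / s) *s e j = 0")
  case True
  then have "s *s (e i + (t / s) *s e j) = 0"
    by (simp only: vec.scale_zero_right)
  then have "s *s e i + t *s e j = 0"
    using assms by (simp add: vec.scale_right_distrib)
  then show ?thesis
    using True by simp
next
  case False
  have "s *s e i + t *s e j = s *s (e i + (t / s) *s e j)"
    using assms by (simp add: vec.scale_right_distrib)
  then show ?thesis
    using colour_scale[OF assms False] by simp
qed

lemma pair_colour:
  assumes "i \<noteq> j" "t \<noteq> 0"
  shows "e i + t *s e j \<noteq> 0" "\<phi> (e i + t *s e j) = i \<or> \<phi> (e i + t *s e j) = j"
proof -
  show nz: "e i + t *s e j \<noteq> 0"
    using add_nonzero_if_colours_differ[OF frame_nonzero] colour_frame colour_scaled_frame assms
    by simp
  show "\<phi> (e i + t *s e j) = i \<or> \<phi> (e i + t *s e j) = j"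
    using colour_add[OF frame_nonzero _ _ nz] colour_frame colour_scaled_frame assms frame_nonzero
    by simp
qed

lemma beats_scaled:
  "beats i j \<Longrightarrow> s \<noteq> 0 \<Longrightarrow> t \<noteq> 0 \<Longrightarrow> \<phi> (s *s e i + t *s e j) = i"
  unfolding beats_def by (simp add: scaled_pair_colour)

lemma beatsI_other:
  assumes "i \<noteq> j" "\<And>t. t \<noteq> 0 \<Longrightarrow> \<phi> (e i + t *s e j) \<noteq> i"
  shows "beats j i"
  unfolding beats_def
proof (intro allI impI)
  fix t :: 'k assume t: "t \<noteq> 0"
  have "\<phi> (e j + t *s e i) = \<phi> (t *s e i + 1 *s e j)"
    by (simp add: add.commute)
  also have "\<dots> = \<phi> (e i + (1 / t) *s e j)"
    using scaled_pair_colour[OF t] .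
  also have "\<dots> = j"
    using pair_colour(2)[OF assms(1), of "1 / t"] assms(2)[of "1 / t"] t by simp
  finally show "\<phi> (e j + t *s e i) = j" .
qed

lemma not_beats_both: "i \<noteq> j \<Longrightarrow> \<not> (beats i j \<and> beats j i)"
  unfolding beats_def using add.commute[of "e i" "e j"] by (metis vec.scale_one zero_neq_one)

text \<open>If the sum had the colour j of y, then restricting first y and then x would leave a point
  of colour j on some line through \<open>e i\<close> and \<open>e j\<close> with \<open>beats i j\<close>.\<close>

lemma colour_dominated_add:
  assumes x: "x \<in> vec.span (e ` S)" "x \<noteq> 0" and y: "y \<in> vec.span (e ` T)"
    and disj: "S \<inter> T = {}" and beats: "\<And>i j. i \<in> S \<Longrightarrow> j \<in> T \<Longrightarrow> beats i j"
  shows "\<phi> (x + y) = \<phi> x"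
proof (cases "y = 0")
  case True
  then show ?thesis by simp
next
  case False
  define i j where "i = \<phi> x" and "j = \<phi> y"
  have ij: "i \<in> S" "j \<in> T"
    using colour_in_span x y False unfolding i_def j_def by auto
  then have "i \<noteq> j"
    using disj by auto
  then have nz: "x + y \<noteq> 0"
    using add_nonzero_if_colours_differ x(2) unfolding i_def j_def by simp
  have "\<phi> (x + y) \<noteq> j"
  proof
    assume sum: "\<phi> (x + y) = j"
    obtain s x' where x': "x = s *s e i + x'" "x' \<in> vec.span (e ` (S - {i}))"
      using frame_split[OF x(1) ij(1)] .
    obtain t y' where y': "y = t *s e j + y'" "y' \<in> vec.span (e ` (T - {j}))"
      using frame_split[OF y ij(2)] .
    have "s \<noteq> 0"
      using colour_in_span[OF x'(2)] x'(1) x(2) unfolding i_def by auto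
    have "t \<noteq> 0"
      using colour_in_span[OF y'(2)] y'(1) False unfolding j_def by auto
    have in_span: "t *s e j \<in> vec.span (e ` insert j S)" "s *s e i \<in> vec.span (e ` {i, j})"
      "t *s e j \<in> vec.span (e ` {i, j})"
      by (auto intro: vec.span_scale vec.span_base)
    have "x \<in> vec.span (e ` insert j S)"
      using x(1) vec.span_mono[of "e ` S" "e ` insert j S"] by blast
    note in_span = in_span this
    have drop_y': "x + t *s e j \<noteq> 0" "\<phi> (x + t *s e j) = j"
      using colour_restrict[of "x + t *s e j" "insert j S" y' "T - {j}"] in_span y' sum nz disj
      by (auto simp: vec.span_add add.assoc)
    then have "\<phi> (s *s e i + t *s e j) = j"
      using colour_restrict[of "s *s e i + t *s e j" "{i, j}" x' "S - {i}"] in_span x' ij disj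
      by (auto simp: vec.span_add add.assoc add.commute[of x'] insert_absorb)
    then show False
      using beats_scaled[OF beats[OF ij] \<open>s \<noteq> 0\<close> \<open>t \<noteq> 0\<close>] \<open>i \<noteq> j\<close> by simp
  qed
  then show ?thesis
    using colour_add[OF x(2) False _ nz] \<open>i \<noteq> j\<close> unfolding i_def j_def by simp
qed

text \<open>The colours on the sides of a rainbow triangle multiply: let \<open>w i j\<close> be the set of t for
  which \<open>e i + t e j\<close> has colour i. If \<open>s \<in> w i j\<close> and \<open>t \<in> w j k\<close>, then the point
  \<open>e i + s e j + s t e k\<close> inside the triangle can only have colour i, because projecting it to
  the sides rules out j and k; so \<open>s t \<in> w i k\<close>.\<close>

lemma side_colours_multiply:
  assumes dist: "i \<noteq> j" "j \<noteq> k" "i \<noteq> k" and st: "s \<noteq> 0" "t \<noteq> 0"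
    and s: "\<phi> (e i + s *s e j) = i" and t: "\<phi> (e j + t *s e k) = j"
  shows "\<phi> (e i + (s * t) *s e k) = i"
proof -
  define v where "v = e i + s *s e j + (s * t) *s e k"
  have mem: "e l \<in> vec.span (e ` S)" if "l \<in> S" for l S
    using that by (auto intro: vec.span_base)
  have base: "e i + s *s e j \<noteq> 0" "\<phi> (e i + s *s e j) \<noteq> \<phi> ((s * t) *s e k)"
    using pair_colour[OF dist(1) st(1)] s colour_scaled_frame[of "s * t" k] st dist by auto
  then have v: "v \<noteq> 0"
    using add_nonzero_if_colours_differ unfolding v_def by blast
  have side: "\<phi> u = \<phi> v"
    if "v = u + r *s e l" "u \<in> vec.span (e ` S)" "l \<notin> S" "\<phi> v \<in> S" for u r l S
  proof -
    have "r *s e l \<in> vec.span (e ` {l})"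
      by (intro vec.span_scale mem) simp
    then show ?thesis
      using colour_restrict(2)[of u S "r *s e l" "{l}"] that v by auto
  qed
  have "\<phi> v \<in> {i, j, k}"
  proof (rule colour_in_span)
    show "v \<in> vec.span (e ` {i, j, k})"
      unfolding v_def by (intro vec.span_add vec.span_scale mem) auto
  qed (fact v)
  have pair: "a *s e l + b *s e m \<in> vec.span (e ` {l, m})" for a b l m
    by (intro vec.span_add vec.span_scale mem) auto
  have "\<phi> v \<noteq> k"
  proof
    assume k: "\<phi> v = k"
    have "\<phi> (s *s e j + (s * t) *s e k) = k"
      using side[OF _ pair, of s j "s * t" k 1 i] k dist by (simp add: v_def)
    then show False
      using scaled_pair_colour[OF st(1), of j "s * t" k] t st dist by simp
  qed
  moreover have "\<phi> v \<noteq> j"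
  proof
    assume j: "\<phi> v = j"
    have "\<phi> (e i + s *s e j) = j"
      using side[OF _ pair, of 1 i s j "s * t" k] j dist by (simp add: v_def)
    then show False
      using s dist by simp
  qed
  ultimately have "\<phi> v = i"
    using \<open>\<phi> v \<in> {i, j, k}\<close> by simp
  then show ?thesis
    using side[OF _ pair, of 1 i "s * t" k s j] dist by (simp add: v_def)
qed

text \<open>Two sides of the triangle are won, either both by their common vertex or both against it.
  The sets of \<open>side_colours_multiply\<close> for the paths \<open>i j k\<close> and \<open>k j i\<close> satisfy the two closure
  conditions of \<open>product_closed_imp_trivial\<close>, since inversion turns \<open>w k j\<close> into the complement of
  \<open>w j k\<close>. So the side \<open>i j\<close> or the side \<open>j k\<close> is won by one of its ends.\<close>

lemma rainbow_triangle:
  assumes dist: "i \<noteq> j" "j \<noteq> k" "i \<noteq> k"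
  shows "beats i j \<and> beats i k \<or> beats j i \<and> beats j k \<or> beats k i \<and> beats k j \<or>
    beats j i \<and> beats k i \<or> beats i j \<and> beats k j \<or> beats i k \<and> beats j k"
proof -
  define w where "w = (\<lambda>i j. {t. t \<noteq> 0 \<and> \<phi> (e i + t *s e j) = i})"
  have compl: "t \<in> - {0} - w l m \<longleftrightarrow> t \<noteq> 0 \<and> inverse t \<in> w m l" if "l \<noteq> m" for l m t
  proof -
    have "\<phi> (e m + inverse t *s e l) = \<phi> (e l + t *s e m)" if "t \<noteq> 0"
      using scaled_pair_colour[OF that, of m 1 l] by (simp add: add.commute field_simps)
    then show ?thesis
      using pair_colour(2)[OF that, of t] that unfolding w_def by auto
  qed
  have closed: "p * q \<in> w l n"
    if "p \<in> w l m" "q \<in> w m n" "l \<noteq> m" "m \<noteq> n" "l \<noteq> n" for p q l m n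
    using side_colours_multiply[of l m n p q] that unfolding w_def by auto
  have coclosed: "p * q \<in> - {0} - w i k" if "p \<in> - {0} - w i j" "q \<in> - {0} - w j k" for p q
    using closed[of "inverse q" k j "inverse p" i] compl[of i j p] compl[of j k q]
      compl[of i k "p * q"] that dist
    by (simp add: mult.commute)
  have full: "beats l m" if "w l m = - {0}" for l m
    using that unfolding beats_def w_def by blast
  have empty: "beats m l" if "w l m = {}" "l \<noteq> m" for l m
    using that by (intro beatsI_other) (auto simp: w_def)
  have full_right: "T = - {0}" if "h \<noteq> 0" "T \<subseteq> - {0}" "\<And>g. g \<noteq> 0 \<Longrightarrow> h * g \<in> T" for T and h :: 'k
  proof -
    have "(*) h ` (- {0}) \<subseteq> T"
      using that(3) by auto
    then show ?thesis
      using that(2) times_image_nonzero[OF that(1)] by simp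
  qed
  have full_left: "T = - {0}" if "h \<noteq> 0" "T \<subseteq> - {0}" "\<And>g. g \<noteq> 0 \<Longrightarrow> g * h \<in> T" for T and h :: 'k
    using that by (intro full_right[of h]) (simp_all add: mult.commute)
  have wsub: "w l m \<subseteq> - {0}" for l m
    unfolding w_def by auto
  have "w i j = {} \<or> w i j = - {0} \<or> w j k = {} \<or> w j k = - {0}"
    using closed dist coclosed wsub by (intro product_closed_imp_trivial[of _ _ "w i k"]) auto
  then consider "w i j = {}" | "w i j = - {0}" | "w j k = {}" | "w j k = - {0}"
    by blast
  \<comment> \<open>If one side is won, then either the other side at j is won in the way that makes j the common
    vertex, or it contributes an element whose multiples exhaust \<open>w i k\<close> or its complement, so that the
    third side is won as well.\<close>
  then show ?thesis
  proof cases
    case 1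
    then have ji: "beats j i"
      using empty dist(1) by simp
    show ?thesis
    proof (cases "w j k = - {0}")
      case True
      then show ?thesis
        using full ji by simp
    next
      case False
      then obtain q where "q \<in> - {0} - w j k"
        using wsub by blast
      then have "- {0} - w i k = - {0}"
        using coclosed[of _ q] 1 by (intro full_left[of q]) simp_all
      then have "w i k = {}"
        using wsub by blast
      then show ?thesis
        using empty dist(3) ji by simp
    qed
  next
    case 2
    then have ij: "beats i j"
      using full by simp
    show ?thesis
    proof (cases "w j k = {}")
      case True
      then show ?thesis
        using empty dist(2) ij by simp
    next
      case False
      then obtain q where "q \<in> w j k"
        by blast
      then have "w i k = - {0}"
        using closed[of _ i j q k] 2 dist wsub by (intro full_left[of q]) auto
      then show ?thesis
        using full ij by simp
    qed
  next
    case 3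
    then have kj: "beats k j"
      using empty dist(2) by simp
    show ?thesis
    proof (cases "w i j = - {0}")
      case True
      then show ?thesis
        using full kj by simp
    next
      case False
      then obtain p where "p \<in> - {0} - w i j"
        using wsub by blast
      then have "- {0} - w i k = - {0}"
        using coclosed[of p] 3 by (intro full_right[of p]) simp_all
      then have "w i k = {}"
        using wsub by blast
      then show ?thesis
        using empty dist(3) kj by simp
    qed
  next
    case 4
    then have jk: "beats j k"
      using full by simp
    show ?thesis
    proof (cases "w i j = {}")
      case True
      then show ?thesis
        using empty dist(1) jk by simp
    next
      case False
      then obtain p where "p \<in> w i j"
        by blast
      then have "w i k = - {0}"
        using closed[of p i j _ k] 4 dist wsub by (intro full_right[of p]) auto
      then show ?thesis
        using full jk by simp
    qed
  qed
qed

end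

text \<open>If every edge is won by one of its ends, then the triangles exclude cycles, and the two top
  vertices of the resulting linear order beat the two others. Otherwise let the edge \<open>a b\<close> be won by neither end. Each further
  vertex either beats both a and b or loses to both. If the two remaining vertices agree in this,
  there are two levels; if not, the one that beats a and b also beats the other one, by the
  triangle on a and these two.\<close>

lemma four_vertex_tournament:
  fixes r :: "'c \<Rightarrow> 'c \<Rightarrow> bool" and w x y z :: 'c
  assumes "distinct [w, x, y, z]"
    and asym: "\<And>i j. i \<noteq> j \<Longrightarrow> \<not> (r i j \<and> r j i)"
    and triangle: "\<And>i j k. i \<noteq> j \<Longrightarrow> j \<noteq> k \<Longrightarrow> i \<noteq> k \<Longrightarrow>
      r i j \<and> r i k \<or> r j i \<and> r j k \<or> r k i \<and> r k j \<or>
      r j i \<and> r k i \<or> r i j \<and> r k j \<or> r i k \<and> r j k"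
  obtains
    (two_levels) a b c d where "distinct [a, b, c, d]" "r a c" "r a d" "r b c" "r b d"
  | (three_levels) a b c d where "distinct [a, b, c, d]" "r d a" "r d b" "r d c" "r a c" "r b c"
      "\<not> r a b" "\<not> r b a"
proof -
  have neutral: thesis if dist: "distinct [a, b, c, d]" and ab: "\<not> r a b" "\<not> r b a" for a b c d
  proof -
    have edge: "r v a \<and> r v b \<or> r a v \<and> r b v" if "v \<noteq> a" "v \<noteq> b" for v
      using triangle[of a b v] asym[of a v] asym[of b v] that dist ab by auto
    have "r c d" if "r c a" "r a d"
      using triangle[of a c d] asym[of a c] asym[of a d] that dist by auto
    moreover have "r d c" if "r d a" "r a c"
      using triangle[of a c d] asym[of a c] asym[of a d] that dist by auto
    ultimately show thesis
      using edge[of c] edge[of d] dist ab two_levels[of a b c d] two_levels[of c d a b]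
        three_levels[of a b d c] three_levels[of a b c d] by auto
  qed
  let ?two = "\<lambda>a b c d. r a c \<and> r a d \<and> r b c \<and> r b d"
  show thesis
  proof (rule ccontr)
    assume no: "\<not> thesis"
    have ne: "w \<noteq> x" "w \<noteq> y" "w \<noteq> z" "x \<noteq> y" "x \<noteq> z" "y \<noteq> z"
      using assms(1) by auto
    have "r w x \<or> r x w" "r w y \<or> r y w" "r w z \<or> r z w" "r x y \<or> r y x" "r x z \<or> r z x"
      "r y z \<or> r z y"
      using no ne neutral[of w x y z] neutral[of w y x z] neutral[of w z x y]
        neutral[of x y w z] neutral[of x z w y] neutral[of y z w x] by auto
    then have "?two w x y z \<or> ?two w y x z \<or> ?two w z x y \<or> ?two x y w z \<or> ?two x z w y \<or>
      ?two y z w x"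
      using triangle[OF ne(1,4,2)] triangle[OF ne(1,5,3)] triangle[OF ne(2,6,3)]
        triangle[OF ne(4,6,5)] asym[OF ne(1)] asym[OF ne(2)] asym[OF ne(3)] asym[OF ne(4)]
        asym[OF ne(5)] asym[OF ne(6)] by argo
    then show False
      using no ne two_levels[of w x y z] two_levels[of w y x z] two_levels[of w z x y]
        two_levels[of x y w z] two_levels[of x z w y] two_levels[of y z w x] by auto
  qed
qed

section \<open>Points, lines and planes as flats of the four-dimensional space\<close>

definition flat :: "('k::field ^ 4) set \<Rightarrow> ('k ^ 4) set set" where
  "flat N = {p \<in> pg_points. p \<subseteq> N}"

lemma pg_lines_eq: "pg_lines = flat ` {N. vec.subspace N \<and> vec.dim N = 2}"
  unfolding pg_lines_def flat_def by auto

lemma pg_planes_eq: "pg_planes = flat ` {N. vec.subspace N \<and> vec.dim N = 3}"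
  unfolding pg_planes_def flat_def by auto

lemma span_singleton_in_pg_points: "vec.span {x} \<in> pg_points \<longleftrightarrow> x \<noteq> 0"
  unfolding pg_points_def by (simp add: vec.dim_singleton)

lemma pg_point_cases:
  assumes "p \<in> pg_points"
  obtains x where "x \<noteq> 0" "p = vec.span {x}"
proof -
  obtain X where "vec.span X = p" "card X = 1"
    using assms vec.basis_subspace_exists[of p] unfolding pg_points_def by auto
  then obtain x where "p = vec.span {x}"
    using card_1_singletonE by metis
  then show ?thesis
    using that[of x] assms span_singleton_in_pg_points by blast
qed

lemma span_singleton_subset_iff: "vec.subspace N \<Longrightarrow> vec.span {x} \<subseteq> N \<longleftrightarrow> x \<in> N"
  using vec.span_minimal[of "{x}" N] vec.span_base[of x "{x}"] by blast

lemma span_singleton_in_flat: "vec.subspace N \<Longrightarrow> vec.span {x} \<in> flat N \<longleftrightarrow> x \<noteq> 0 \<and> x \<in> N"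
  unfolding flat_def by (auto simp: span_singleton_in_pg_points span_singleton_subset_iff)

lemma in_flat_cases:
  assumes "p \<in> flat N"
  obtains x where "x \<noteq> 0" "x \<in> N" "p = vec.span {x}"
  using assms pg_point_cases vec.span_base[of _ "{_}"] unfolding flat_def
  by (metis (no_types, lifting) insertI1 mem_Collect_eq subsetD vec.span_base)

lemma flat_subset_iff:
  assumes "vec.subspace N" "vec.subspace M"
  shows "flat N \<subseteq> flat M \<longleftrightarrow> N \<subseteq> M"
proof
  assume sub: "flat N \<subseteq> flat M"
  show "N \<subseteq> M"
  proof
    fix x assume "x \<in> N"
    then show "x \<in> M"
      using sub assms span_singleton_in_flat[of N x] span_singleton_in_flat[of M x]
        vec.subspace_0[of M] by (cases "x = 0") blast+
  qed
qed (auto simp: flat_def)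

lemma span_scaled_singleton:
  fixes x :: "'k::field ^ 'n"
  shows "s \<noteq> 0 \<Longrightarrow> vec.span {s *s x} = vec.span {x}"
  using vec.span_image_scale[of "{x}" "\<lambda>_. s"] by simp

lemma dim_span_pair:
  fixes x y :: "'k::field ^ 'n"
  assumes "x \<noteq> 0" "y \<notin> vec.span {x}"
  shows "vec.dim (vec.span {x, y}) = 2"
proof -
  have "vec.independent {x, y}"
    using assms by (simp add: vec.independent_insert insert_commute[of x])
  moreover have "x \<noteq> y"
    using assms(2) vec.span_base[of y "{y}"] by auto
  ultimately show ?thesis
    by (simp add: vec.dim_eq_card_independent)
qed

lemma span_eqI:
  fixes N :: "('k::field ^ 'n) set"
  assumes "vec.subspace N" "X \<subseteq> N" "vec.dim (vec.span X) = vec.dim N"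
  shows "N = vec.span X"
  using vec.subspace_dim_equal[of "vec.span X" N] vec.span_minimal[of X N] assms by simp

section \<open>The frame of an epimorphism onto the tetrahedron\<close>

locale tetrahedron_frame =
  fixes \<epsilon> :: "('k::{field,finite} ^ 4) set \<Rightarrow> 4" and e :: "4 \<Rightarrow> 'k ^ 4"
  assumes frame: "rainbow_free_frame (\<lambda>x. \<epsilon> (vec.span {x})) e"

sublocale tetrahedron_frame \<subseteq> rainbow_free_frame "\<lambda>x. \<epsilon> (vec.span {x})" e
  by (rule frame)

text \<open>The points of x, y and \<open>x + y\<close> lie on one line, and the image of this line is an edge, which has
  only two vertices.\<close>

lemma epimorphism_imp_frame:
  fixes f :: "('k::{field,finite} ^ 4) set \<Rightarrow> 4"
  assumes "geometry_epimorphism pg_points pg_lines K4_points K4_lines f g"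
  obtains e where "tetrahedron_frame f e"
proof -
  have onto: "f ` pg_points = UNIV" and lines: "g ` pg_lines \<subseteq> K4_lines"
    and inc: "\<And>p l. p \<in> pg_points \<Longrightarrow> l \<in> pg_lines \<Longrightarrow> p \<in> l \<Longrightarrow> f p \<in> g l"
    using assms unfolding geometry_epimorphism_def geometry_morphism_def K4_points_def by auto
  have "\<exists>x. x \<noteq> 0 \<and> f (vec.span {x}) = i" for i
  proof -
    obtain p where "p \<in> pg_points" "f p = i"
      using onto by (metis UNIV_I imageE)
    then show ?thesis
      using pg_point_cases by metis
  qed
  then obtain e where e: "\<And>i. e i \<noteq> 0" "\<And>i. f (vec.span {e i}) = i"
    by metis
  have "rainbow_free_frame (\<lambda>x. f (vec.span {x})) e"
  proof
    fix s :: 'k and x :: "'k ^ 4" assume "s \<noteq> 0" "x \<noteq> 0"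
    then show "f (vec.span {s *s x}) = f (vec.span {x})"
      by (simp add: span_scaled_singleton)
  next
    fix x y :: "'k ^ 4"
    assume nz: "x \<noteq> 0" "y \<noteq> 0" "x + y \<noteq> 0"
      and colours: "f (vec.span {x}) \<noteq> f (vec.span {y})"
    show "f (vec.span {x + y}) = f (vec.span {x}) \<or> f (vec.span {x + y}) = f (vec.span {y})"
    proof -
      have y: "y \<notin> vec.span {x}"
      proof
        assume "y \<in> vec.span {x}"
        then have "vec.span {x} = vec.span {y}"
          using nz by (intro span_eqI) (simp_all add: vec.dim_singleton)
        then show False
          using colours by simp
      qed
      define l where "l = flat (vec.span {x, y})"
      have l: "l \<in> pg_lines"
        unfolding l_def pg_lines_eq using dim_span_pair[OF nz(1) y] by auto
      then have "card (g l) = 2"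
        using lines unfolding K4_lines_def by auto
      moreover have "f (vec.span {z}) \<in> g l" if "z \<in> {x, y, x + y}" for z
        using that nz l
        by (intro inc) (auto simp: l_def span_singleton_in_pg_points span_singleton_in_flat
            vec.span_add vec.span_base)
      then have "f (vec.span {x}) \<in> g l" "f (vec.span {y}) \<in> g l" "f (vec.span {x + y}) \<in> g l"
        by simp_all
      ultimately show ?thesis
        using colours by (auto simp: card_2_iff)
    qed
  qed (use e in auto)
  then show ?thesis
    using that tetrahedron_frame.intro by blast
qed

context tetrahedron_frame
begin

lemma span_singleton_in_fibre:
  "vec.span {x} \<in> point_fibre \<epsilon> i \<longleftrightarrow> x \<noteq> 0 \<and> \<epsilon> (vec.span {x}) = i"
  unfolding point_fibre_def by (simp add: span_singleton_in_pg_points)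

lemma in_fibre_cases:
  assumes "p \<in> point_fibre \<epsilon> i"
  obtains x where "x \<noteq> 0" "\<epsilon> (vec.span {x}) = i" "p = vec.span {x}"
  using assms pg_point_cases unfolding point_fibre_def by blast

lemma decompose:
  assumes "S \<union> T = UNIV"
  obtains y z where "x = y + z" "y \<in> vec.span (e ` S)" "z \<in> vec.span (e ` T)"
proof -
  have "vec.span (range e) = UNIV"
    using dim_span_frame[of UNIV] vec.subspace_dim_equal[of "vec.span (range e)" UNIV]
    by (simp add: vec.dim_UNIV card_cart_basis)
  then have "x \<in> vec.span (e ` S \<union> e ` T)"
    using assms by (simp flip: image_Un)
  then show ?thesis
    using that by (auto simp: vec.span_Un)
qed

lemma not_in_span_if_colours_differ:
  assumes "y \<noteq> 0" "\<epsilon> (vec.span {x}) \<noteq> \<epsilon> (vec.span {y})"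
  shows "y \<notin> vec.span {x}"
proof
  assume "y \<in> vec.span {x}"
  then obtain s where "y = s *s x"
    by (auto simp: vec.span_singleton)
  then show False
    using assms colour_scale[of s x] by auto
qed

lemma dim_span_if_colours_differ:
  assumes "x \<noteq> 0" "y \<noteq> 0" "\<epsilon> (vec.span {x}) \<noteq> \<epsilon> (vec.span {y})"
  shows "vec.dim (vec.span {x, y}) = 2"
  using dim_span_pair not_in_span_if_colours_differ assms by blast

lemma frame_line:
  assumes "a \<noteq> b"
  defines "U \<equiv> flat (vec.span (e ` {a, b}))"
  shows "U \<in> pg_lines" "card (U \<inter> point_fibre \<epsilon> a) \<ge> 1" "card (U \<inter> point_fibre \<epsilon> b) \<ge> 1"
    "U \<subseteq> point_fibre \<epsilon> a \<union> point_fibre \<epsilon> b"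
proof -
  show "U \<in> pg_lines"
    unfolding U_def pg_lines_eq using assms(1) dim_span_frame[of "{a, b}"] by auto
  have "vec.span {e i} \<in> U \<inter> point_fibre \<epsilon> i" if "i \<in> {a, b}" for i
    using that frame_nonzero colour_frame unfolding U_def
    by (auto simp: span_singleton_in_fibre span_singleton_in_flat intro: vec.span_base)
  then have "U \<inter> point_fibre \<epsilon> i \<noteq> {}" if "i \<in> {a, b}" for i
    using that by blast
  then show "card (U \<inter> point_fibre \<epsilon> a) \<ge> 1" "card (U \<inter> point_fibre \<epsilon> b) \<ge> 1"
    by (simp_all add: Suc_le_eq card_gt_0_iff)
  show "U \<subseteq> point_fibre \<epsilon> a \<union> point_fibre \<epsilon> b"
  proof
    fix p assume "p \<in> U"
    then obtain x where x: "x \<noteq> 0" "x \<in> vec.span (e ` {a, b})" "p = vec.span {x}"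
      unfolding U_def by (rule in_flat_cases)
    then show "p \<in> point_fibre \<epsilon> a \<union> point_fibre \<epsilon> b"
      using colour_in_span[OF x(2,1)] by (auto simp: span_singleton_in_fibre)
  qed
qed

text \<open>This recovers the condition on lines from its vector form \<open>colour_add\<close>.\<close>

lemma line_two_colours:
  assumes l: "l \<in> pg_lines" "p \<in> l" "q \<in> l" "r \<in> l" and differ: "\<epsilon> p \<noteq> \<epsilon> q"
  shows "\<epsilon> r = \<epsilon> p \<or> \<epsilon> r = \<epsilon> q"
proof -
  obtain M where M: "vec.subspace M" "vec.dim M = 2" "l = flat M"
    using l(1) unfolding pg_lines_eq by auto
  obtain x where x: "x \<noteq> 0" "x \<in> M" "p = vec.span {x}"
    using l(2) M(3) in_flat_cases by blast
  obtain y where y: "y \<noteq> 0" "y \<in> M" "q = vec.span {y}"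
    using l(3) M(3) in_flat_cases by blast
  obtain z where z: "z \<noteq> 0" "z \<in> M" "r = vec.span {z}"
    using l(4) M(3) in_flat_cases by blast
  have "M = vec.span {x, y}"
    using M x y differ dim_span_if_colours_differ by (intro span_eqI) auto
  then obtain s t where st: "z = s *s x + t *s y"
    using z(2) by (auto simp: vec.span_insert vec.span_singleton algebra_simps)
  show ?thesis
  proof (cases "s = 0 \<or> t = 0")
    case True
    then show ?thesis
      using st x y z span_scaled_singleton[of t y] span_scaled_singleton[of s x] by auto
  next
    case False
    then show ?thesis
      using st x y z differ colour_add[of "s *s x" "t *s y"] span_scaled_singleton[of t y]
        span_scaled_singleton[of s x] by auto
  qed
qed

section \<open>The colouring of the whole space\<close>

text \<open>The space is the direct sum of \<open>H = span (e a, e b)\<close> and \<open>L = span (e c, e d)\<close>, and a vector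
  with nonzero component y in H has the colour of y. The transversal through the point of
  \<open>y + z\<close> is the line joining the points of y and z; its points outside the line of L have a nonzero
  multiple of y as component in H.\<close>

lemma two_levels_structure:
  assumes dist: "distinct [a, b, c, d]"
    and beats: "beats a c" "beats a d" "beats b c" "beats b d"
  defines "A \<equiv> point_fibre \<epsilon> a" and "B \<equiv> point_fibre \<epsilon> b"
    and "C \<equiv> point_fibre \<epsilon> c" and "D \<equiv> point_fibre \<epsilon> d"
  shows "\<exists>U\<in>pg_lines. card (U \<inter> A) \<ge> 1 \<and> card (U \<inter> B) \<ge> 1 \<and> U \<subseteq> A \<union> B \<and>
    (\<exists>V\<in>pg_lines. card (C \<inter> V) \<ge> 1 \<and> card (D \<inter> V) \<ge> 1 \<and> C \<union> D = V \<and>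
      (\<forall>u\<in>pg_points. u \<notin> U \<and> u \<notin> V \<longrightarrow>
        (\<exists>!W. W \<in> pg_lines \<and> u \<in> W \<and> W \<inter> U \<noteq> {} \<and> W \<inter> V \<noteq> {}) \<and>
        (\<forall>W\<in>pg_lines. u \<in> W \<and> W \<inter> U \<noteq> {} \<and> W \<inter> V \<noteq> {} \<longrightarrow>
          ((\<exists>a\<in>A. W \<inter> U = {a}) \<longrightarrow> W - (W \<inter> V) \<subseteq> A) \<and>
          ((\<exists>b\<in>B. W \<inter> U = {b}) \<longrightarrow> W - (W \<inter> V) \<subseteq> B))))"
proof -
  define H L U V where "H = vec.span (e ` {a, b})" and "L = vec.span (e ` {c, d})"
    and "U = flat H" and "V = flat L"
  have U: "U \<in> pg_lines" "card (U \<inter> A) \<ge> 1" "card (U \<inter> B) \<ge> 1" "U \<subseteq> A \<union> B"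
    using frame_line[of a b] dist unfolding U_def H_def A_def B_def by auto
  have V: "V \<in> pg_lines" "card (C \<inter> V) \<ge> 1" "card (D \<inter> V) \<ge> 1" "V \<subseteq> C \<union> D"
    using frame_line[of c d] dist unfolding V_def L_def C_def D_def by (auto simp: Int_commute)
  have sub: "vec.subspace H" "vec.subspace L"
    unfolding H_def L_def by auto
  have "card {a, b, c, d} = CARD(4)"
    using dist by simp
  then have univ: "{a, b} \<union> {c, d} = UNIV"
    using card_subset_eq[of UNIV "{a, b, c, d}"] by auto
  have disj: "{a, b} \<inter> {c, d} = {}"
    using dist by auto
  have top: "\<epsilon> (vec.span {y + z}) = \<epsilon> (vec.span {y})" if "y \<in> H" "y \<noteq> 0" "z \<in> L" for y z
    using that beats disj unfolding H_def L_def
    by (intro colour_dominated_add[of _ "{a, b}" _ "{c, d}"]) auto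
  have colour_H: "\<epsilon> (vec.span {y}) \<in> {a, b}" if "y \<in> H" "y \<noteq> 0" for y
    using that colour_in_span unfolding H_def by blast
  have colour_L: "\<epsilon> (vec.span {z}) \<in> {c, d}" if "z \<in> L" "z \<noteq> 0" for z
    using that colour_in_span unfolding L_def by blast
  have HL: "x = 0" if "x \<in> H" "x \<in> L" for x
    using that disj eq_zero_if_in_complementary_spans unfolding H_def L_def by blast
  have "C \<union> D \<subseteq> V"
  proof
    fix p assume "p \<in> C \<union> D"
    then obtain x where x: "x \<noteq> 0" "\<epsilon> (vec.span {x}) \<in> {c, d}" "p = vec.span {x}"
      unfolding C_def D_def by (auto elim: in_fibre_cases)
    obtain y z where yz: "x = y + z" "y \<in> H" "z \<in> L"
      using decompose[OF univ] unfolding H_def L_def .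
    have "y = 0"
    proof (rule ccontr)
      assume "y \<noteq> 0"
      then show False
        using top[OF yz(2) _ yz(3)] colour_H[OF yz(2)] x(2) yz(1) dist by auto
    qed
    then show "p \<in> V"
      using x yz sub unfolding V_def by (simp add: span_singleton_in_flat)
  qed
  then have CD: "C \<union> D = V"
    using V(4) by auto
  have transversal: "(\<exists>!W. W \<in> pg_lines \<and> u \<in> W \<and> W \<inter> U \<noteq> {} \<and> W \<inter> V \<noteq> {}) \<and>
      (\<forall>W\<in>pg_lines. u \<in> W \<and> W \<inter> U \<noteq> {} \<and> W \<inter> V \<noteq> {} \<longrightarrow>
        ((\<exists>a\<in>A. W \<inter> U = {a}) \<longrightarrow> W - (W \<inter> V) \<subseteq> A) \<and>
        ((\<exists>b\<in>B. W \<inter> U = {b}) \<longrightarrow> W - (W \<inter> V) \<subseteq> B))"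
    if u: "u \<in> pg_points" "u \<notin> U" "u \<notin> V" for u
  proof -
    obtain x where x: "x \<noteq> 0" "u = vec.span {x}"
      using pg_point_cases[OF u(1)] .
    obtain y z where yz: "x = y + z" "y \<in> H" "z \<in> L"
      using decompose[OF univ] unfolding H_def L_def .
    have nz: "y \<noteq> 0" "z \<noteq> 0"
      using u x yz sub unfolding U_def V_def by (auto simp: span_singleton_in_flat)
    have differ: "\<epsilon> (vec.span {y}) \<noteq> \<epsilon> (vec.span {z})"
      using colour_H[OF yz(2) nz(1)] colour_L[OF yz(3) nz(2)] dist by auto
    define W\<^sub>0 where "W\<^sub>0 = flat (vec.span {y, z})"
    have W\<^sub>0: "W\<^sub>0 \<in> pg_lines" "u \<in> W\<^sub>0" "vec.span {y} \<in> W\<^sub>0 \<inter> U" "vec.span {z} \<in> W\<^sub>0 \<inter> V"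
      using dim_span_if_colours_differ[OF nz differ] x yz nz sub
      unfolding W\<^sub>0_def pg_lines_eq U_def V_def
      by (auto simp: span_singleton_in_flat vec.span_add vec.span_base)
    have unique: "W = W\<^sub>0" if W: "W \<in> pg_lines" "u \<in> W" "W \<inter> U \<noteq> {}" "W \<inter> V \<noteq> {}" for W
    proof -
      obtain M where M: "vec.subspace M" "vec.dim M = 2" "W = flat M"
        using W(1) unfolding pg_lines_eq by auto
      obtain p q where pq: "p \<in> flat M" "p \<in> flat H" "q \<in> flat M" "q \<in> flat L"
        using W(3,4) M(3) unfolding U_def V_def by blast
      obtain y' where y': "y' \<noteq> 0" "y' \<in> H" "p = vec.span {y'}"
        using pq(2) by (rule in_flat_cases)
      obtain z' where z': "z' \<noteq> 0" "z' \<in> L" "q = vec.span {z'}"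
        using pq(4) by (rule in_flat_cases)
      have in_M: "x \<in> M" "y' \<in> M" "z' \<in> M"
        using pq y' z' x W(2) M by (auto simp: span_singleton_in_flat)
      have "\<epsilon> (vec.span {y'}) \<noteq> \<epsilon> (vec.span {z'})"
        using colour_H[OF y'(2,1)] colour_L[OF z'(2,1)] dist by auto
      then have "M = vec.span {y', z'}"
        using dim_span_if_colours_differ[OF y'(1) z'(1)] M in_M by (intro span_eqI) auto
      then obtain s t where st: "x = s *s y' + t *s z'"
        using in_M(1) by (auto simp: vec.span_insert vec.span_singleton algebra_simps)
      have eq: "y - s *s y' = t *s z' - z"
        using st yz(1) by (simp add: algebra_simps)
      have "y - s *s y' \<in> H" "t *s z' - z \<in> L"
        using sub y' z' yz by (auto intro: vec.subspace_diff vec.subspace_scale)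
      then have "y - s *s y' = 0"
        using HL[of "y - s *s y'"] unfolding eq by blast
      moreover from this have "t *s z' - z = 0"
        unfolding eq .
      ultimately have "y = s *s y'" "z = t *s z'"
        by simp_all
      then have "y \<in> M" "z \<in> M"
        using vec.subspace_scale[OF M(1)] in_M by simp_all
      then have "M = vec.span {y, z}"
        using dim_span_if_colours_differ[OF nz differ] M by (intro span_eqI) auto
      then show ?thesis
        unfolding M(3) W\<^sub>0_def by simp
    qed
    have colour_W\<^sub>0: "p \<in> point_fibre \<epsilon> (\<epsilon> (vec.span {y}))" if p: "p \<in> W\<^sub>0" "p \<notin> V" for p
    proof -
      obtain v where v: "v \<noteq> 0" "v \<in> vec.span {y, z}" "p = vec.span {v}"
        using p(1) unfolding W\<^sub>0_def by (rule in_flat_cases)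
      then obtain s t where st: "v = s *s y + t *s z"
        by (auto simp: vec.span_insert vec.span_singleton algebra_simps)
      have "s \<noteq> 0"
        using st v p(2) sub yz unfolding V_def
        by (auto simp: span_singleton_in_flat intro: vec.subspace_scale)
      then have "\<epsilon> (vec.span {v}) = \<epsilon> (vec.span {s *s y})"
        using st sub yz nz by (auto intro!: top vec.subspace_scale)
      then show ?thesis
        using v \<open>s \<noteq> 0\<close> by (simp add: span_singleton_in_fibre span_scaled_singleton)
    qed
    have fibre_W\<^sub>0: "W\<^sub>0 - (W\<^sub>0 \<inter> V) \<subseteq> point_fibre \<epsilon> i"
      if meets: "\<exists>p\<in>point_fibre \<epsilon> i. W\<^sub>0 \<inter> U = {p}" for i
    proof -
      obtain p where "p \<in> point_fibre \<epsilon> i" "W\<^sub>0 \<inter> U = {p}"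
        using meets by blast
      then have "vec.span {y} \<in> point_fibre \<epsilon> i"
        using W\<^sub>0(3) by simp
      then show ?thesis
        using colour_W\<^sub>0 unfolding point_fibre_def by auto
    qed
    show ?thesis
    proof (intro conjI ballI impI)
      show "\<exists>!W. W \<in> pg_lines \<and> u \<in> W \<and> W \<inter> U \<noteq> {} \<and> W \<inter> V \<noteq> {}"
      proof (rule ex1I[of _ W\<^sub>0])
        show "W\<^sub>0 \<in> pg_lines \<and> u \<in> W\<^sub>0 \<and> W\<^sub>0 \<inter> U \<noteq> {} \<and> W\<^sub>0 \<inter> V \<noteq> {}"
          using W\<^sub>0 by blast
      qed (use unique in simp)
    next
      fix W assume "W \<in> pg_lines" "u \<in> W \<and> W \<inter> U \<noteq> {} \<and> W \<inter> V \<noteq> {}"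
      then have W: "W = W\<^sub>0"
        using unique by simp
      show "W - (W \<inter> V) \<subseteq> A" if "\<exists>a\<in>A. W \<inter> U = {a}"
        using fibre_W\<^sub>0[of a] that unfolding W A_def .
      show "W - (W \<inter> V) \<subseteq> B" if "\<exists>b\<in>B. W \<inter> U = {b}"
        using fibre_W\<^sub>0[of b] that unfolding W B_def .
    qed
  qed
  show ?thesis
    using U V CD transversal by (intro bexI[of _ U] conjI bexI[of _ V]) auto
qed

text \<open>A vector outside the plane \<open>N = span (e a, e b, e c)\<close> has a nonzero component along \<open>e d\<close>,
  hence colour d. A vector of N with a nonzero component y in \<open>H = span (e a, e b)\<close> has the colour
  of y, so \<open>e c\<close> is the only point of colour c and the plane is a cone over the line of H. Any other
  plane through this line meets N in this line only.\<close>

lemma three_levels_structure: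
  assumes dist: "distinct [a, b, c, d]"
    and beats: "beats d a" "beats d b" "beats d c" "beats a c" "beats b c"
    and neutral: "\<not> beats a b" "\<not> beats b a"
  defines "A \<equiv> point_fibre \<epsilon> a" and "B \<equiv> point_fibre \<epsilon> b"
    and "C \<equiv> point_fibre \<epsilon> c" and "D \<equiv> point_fibre \<epsilon> d"
  shows "\<exists>U\<in>pg_lines. card (U \<inter> A) \<ge> 1 \<and> card (U \<inter> B) \<ge> 1 \<and> U \<subseteq> A \<union> B \<and>
    (\<exists>!P. P \<in> pg_planes \<and> U \<subseteq> P \<and> type_II_plane A B C P) \<and>
    (\<forall>P\<in>pg_planes. U \<subseteq> P \<and> \<not> type_II_plane A B C P \<longrightarrow> P - U \<subseteq> D)"
proof -
  define H N U P c\<^sub>0 where "H = vec.span (e ` {a, b})" and "N = vec.span (e ` {a, b, c})"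
    and "U = flat H" and "P = flat N" and "c\<^sub>0 = vec.span {e c}"
  have U: "U \<in> pg_lines" "card (U \<inter> A) \<ge> 1" "card (U \<inter> B) \<ge> 1" "U \<subseteq> A \<union> B"
    using frame_line[of a b] dist unfolding U_def H_def A_def B_def by auto
  have sub: "vec.subspace H" "vec.subspace N"
    unfolding H_def N_def by auto
  have HN: "H \<subseteq> N"
    unfolding H_def N_def by (intro vec.span_mono) auto
  have dim_N: "vec.dim N = 3"
    unfolding N_def using dim_span_frame[of "{a, b, c}"] dist by simp
  have e_in: "e a \<in> H" "e b \<in> H" "e a \<in> N" "e b \<in> N" "e c \<in> N"
    unfolding H_def N_def by (auto intro: vec.span_base)
  have P: "P \<in> pg_planes" "U \<subseteq> P"
    unfolding P_def U_def pg_planes_eq using sub dim_N HN by (auto simp: flat_subset_iff)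
  have "card {a, b, c, d} = CARD(4)"
    using dist by simp
  then have univ: "{d} \<union> {a, b, c} = UNIV"
    using card_subset_eq[of UNIV "{a, b, c, d}"] by auto
  have colour_N: "\<epsilon> (vec.span {x}) \<in> {a, b, c}" if "x \<in> N" "x \<noteq> 0" for x
    using that colour_in_span unfolding N_def by blast
  have colour_H: "\<epsilon> (vec.span {x}) \<in> {a, b}" if "x \<in> H" "x \<noteq> 0" for x
    using that colour_in_span unfolding H_def by blast
  have colour_outside: "\<epsilon> (vec.span {x}) = d" if "x \<notin> N" for x
  proof -
    obtain y z where yz: "x = y + z" "y \<in> vec.span (e ` {d})" "z \<in> N"
      using decompose[OF univ] unfolding N_def .
    then have "y \<noteq> 0"
      using that by auto
    have "\<epsilon> (vec.span {y + z}) = \<epsilon> (vec.span {y})"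
      using yz \<open>y \<noteq> 0\<close> beats dist unfolding N_def
      by (intro colour_dominated_add[of _ "{d}" _ "{a, b, c}"]) auto
    then show ?thesis
      using colour_in_span[OF yz(2) \<open>y \<noteq> 0\<close>] yz(1) by simp
  qed
  have split_N: "\<exists>s y. x = s *s e c + y \<and> y \<in> H" if "x \<in> N" for x
  proof -
    have "{a, b, c} - {c} = {a, b}"
      using dist by auto
    then show ?thesis
      using frame_split[of x "{a, b, c}" c] that unfolding N_def H_def by (metis insertCI)
  qed
  have C: "C = {c\<^sub>0}"
  proof
    show "{c\<^sub>0} \<subseteq> C"
      unfolding C_def c\<^sub>0_def using frame_nonzero colour_frame
      by (simp add: span_singleton_in_fibre)
    show "C \<subseteq> {c\<^sub>0}"
    proof
      fix p assume "p \<in> C"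
      then obtain x where x: "x \<noteq> 0" "\<epsilon> (vec.span {x}) = c" "p = vec.span {x}"
        unfolding C_def by (rule in_fibre_cases)
      then have "x \<in> N"
        using colour_outside[of x] dist by auto
      then obtain s y where sy: "x = s *s e c + y" "y \<in> H"
        using split_N by blast
      have "y = 0"
      proof (rule ccontr)
        assume "y \<noteq> 0"
        then have "\<epsilon> (vec.span {y + s *s e c}) = \<epsilon> (vec.span {y})"
          using sy(2) beats dist unfolding H_def
          by (intro colour_dominated_add[of _ "{a, b}" _ "{c}"])
            (auto intro: vec.span_scale vec.span_base)
        then show False
          using sy x colour_H[of y] \<open>y \<noteq> 0\<close> dist by (auto simp: add.commute)
      qed
      then show "p \<in> {c\<^sub>0}"
        using x sy unfolding c\<^sub>0_def by (auto simp: span_scaled_singleton)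
    qed
  qed
  have c\<^sub>0: "c\<^sub>0 \<in> P" "\<epsilon> c\<^sub>0 = c"
    using sub e_in frame_nonzero colour_frame unfolding P_def c\<^sub>0_def
    by (auto simp: span_singleton_in_flat)
  have P_colours: "P - (A \<union> B) = {c\<^sub>0}"
  proof
    show "{c\<^sub>0} \<subseteq> P - (A \<union> B)"
      using c\<^sub>0 dist unfolding A_def B_def point_fibre_def by auto
    show "P - (A \<union> B) \<subseteq> {c\<^sub>0}"
    proof
      fix p assume p: "p \<in> P - (A \<union> B)"
      then obtain x where x: "x \<noteq> 0" "x \<in> N" "p = vec.span {x}"
        unfolding P_def using in_flat_cases by blast
      then have "p \<in> C"
        using colour_N[OF x(2,1)] p unfolding A_def B_def C_def
        by (auto simp: span_singleton_in_fibre)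
      then show "p \<in> {c\<^sub>0}"
        using C by simp
    qed
  qed
  define pencil where "pencil = {l \<in> pg_lines. l \<subseteq> P \<and> c\<^sub>0 \<in> l}"
  define Ah Bh where "Ah = {l \<in> pencil. l \<inter> A \<noteq> {}}" and "Bh = {l \<in> pencil. l \<inter> B \<noteq> {}}"
  have join: "flat (vec.span {e c, x}) \<in> pencil" "vec.span {x} \<in> flat (vec.span {e c, x})"
    if x: "x \<in> N" "x \<noteq> 0" "\<epsilon> (vec.span {x}) \<noteq> c" for x
  proof -
    have "vec.dim (vec.span {e c, x}) = 2"
      using x frame_nonzero colour_frame by (intro dim_span_if_colours_differ) auto
    moreover have "vec.span {e c, x} \<subseteq> N"
      using x e_in sub by (intro vec.span_minimal) auto
    ultimately show "flat (vec.span {e c, x}) \<in> pencil"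
      unfolding pencil_def pg_lines_eq P_def c\<^sub>0_def using sub frame_nonzero
      by (auto simp: flat_subset_iff span_singleton_in_flat vec.span_base)
    show "vec.span {x} \<in> flat (vec.span {e c, x})"
      using x by (auto simp: span_singleton_in_flat vec.span_base)
  qed
  have two_lines: "card {l \<in> pencil. l \<inter> point_fibre \<epsilon> i \<noteq> {}} \<ge> 2"
    if ij: "{i, j} = {a, b}" "i \<noteq> j" "\<not> beats j i" for i j
  proof -
    have i: "i \<in> {a, b}" "j \<in> {a, b}"
      using ij(1) by auto
    then have ic: "i \<noteq> c" "j \<noteq> c" "e i \<in> N" "e j \<in> N"
      using dist e_in by auto
    \<comment> \<open>As j does not beat i, the edge has a second point of colour i besides \<open>e i\<close>; both are joined
      to \<open>c\<^sub>0\<close>.\<close>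
    obtain t where t: "t \<noteq> 0" "\<epsilon> (vec.span {e i + t *s e j}) = i"
      using beatsI_other[OF ij(2)] ij(3) by blast
    define x where "x = e i + t *s e j"
    have x: "x \<in> N" "x \<noteq> 0" "\<epsilon> (vec.span {x}) = i"
      using ic sub t pair_colour(1)[OF ij(2) t(1)] unfolding x_def
      by (auto intro: vec.subspace_add vec.subspace_scale)
    define l\<^sub>1 l\<^sub>2 where "l\<^sub>1 = flat (vec.span {e c, e i})" and "l\<^sub>2 = flat (vec.span {e c, x})"
    have "l\<^sub>1 \<noteq> l\<^sub>2"
    proof
      assume "l\<^sub>1 = l\<^sub>2"
      then have "x \<in> vec.span (e ` {c, i})"
        using join(2)[of x] x ic span_singleton_in_flat[of "vec.span {e c, e i}" x]
        unfolding l\<^sub>1_def l\<^sub>2_def by auto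
      moreover have "e i \<in> vec.span (e ` {c, i})"
        by (intro vec.span_base) auto
      ultimately have "x - e i \<in> vec.span (e ` {c, i})"
        by (rule vec.span_diff)
      then have "j \<in> {c, i}"
        using colour_in_span[of "t *s e j" "{c, i}"] colour_scaled_frame[OF t(1)] t(1)
          frame_nonzero unfolding x_def by simp
      then show False
        using ij(2) ic by auto
    qed
    moreover have "{l\<^sub>1, l\<^sub>2} \<subseteq> {l \<in> pencil. l \<inter> point_fibre \<epsilon> i \<noteq> {}}"
      using join[of x] join[of "e i"] x ic frame_nonzero colour_frame unfolding l\<^sub>1_def l\<^sub>2_def
      by (auto simp: span_singleton_in_fibre disjoint_iff)
    ultimately show ?thesis
      using card_mono[of "{l \<in> pencil. l \<inter> point_fibre \<epsilon> i \<noteq> {}}" "{l\<^sub>1, l\<^sub>2}"] by simp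
  qed
  have covered: "l \<in> Ah \<union> Bh" if l: "l \<in> pencil" for l
  proof -
    obtain M where M: "vec.subspace M" "vec.dim M = 2" "l = flat M"
      using l unfolding pencil_def pg_lines_eq by auto
    have "\<not> M \<subseteq> vec.span {e c}"
      using vec.dim_subset[of M "vec.span {e c}"] M(2) by (auto simp: vec.dim_singleton frame_nonzero)
    then obtain x where x: "x \<in> M" "x \<notin> vec.span {e c}"
      by blast
    then have "x \<noteq> 0" "vec.span {x} \<noteq> c\<^sub>0"
      using vec.span_zero vec.span_base[of x "{x}"] unfolding c\<^sub>0_def by auto
    moreover have "vec.span {x} \<in> l"
      using x(1) M \<open>x \<noteq> 0\<close> by (simp add: span_singleton_in_flat)
    ultimately show ?thesis
      using l P_colours unfolding Ah_def Bh_def pencil_def by blast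
  qed
  \<comment> \<open>A line in both classes would carry the three colours a, b, c.\<close>
  have disjoint: "Ah \<inter> Bh = {}"
  proof (rule ccontr)
    assume "Ah \<inter> Bh \<noteq> {}"
    then obtain l p q where "l \<in> pencil" "p \<in> l" "p \<in> A" "q \<in> l" "q \<in> B"
      unfolding Ah_def Bh_def by blast
    then show False
      using line_two_colours[of l p q c\<^sub>0] c\<^sub>0 dist
      unfolding pencil_def A_def B_def point_fibre_def by auto
  qed
  have cone: "point_fibre \<epsilon> i \<inter> P = \<Union>{l \<in> pencil. l \<inter> point_fibre \<epsilon> i \<noteq> {}} - {c\<^sub>0}"
    if i: "i \<noteq> c" for i
  proof
    show "point_fibre \<epsilon> i \<inter> P \<subseteq> \<Union>{l \<in> pencil. l \<inter> point_fibre \<epsilon> i \<noteq> {}} - {c\<^sub>0}"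
    proof
      fix p assume p: "p \<in> point_fibre \<epsilon> i \<inter> P"
      then obtain x where x: "x \<noteq> 0" "x \<in> N" "p = vec.span {x}"
        unfolding P_def using in_flat_cases by blast
      have "\<epsilon> p = i"
        using p unfolding point_fibre_def by simp
      then show "p \<in> \<Union>{l \<in> pencil. l \<inter> point_fibre \<epsilon> i \<noteq> {}} - {c\<^sub>0}"
        using join[OF x(2,1)] x i p c\<^sub>0 by blast
    qed
    show "\<Union>{l \<in> pencil. l \<inter> point_fibre \<epsilon> i \<noteq> {}} - {c\<^sub>0} \<subseteq> point_fibre \<epsilon> i \<inter> P"
    proof
      fix p assume "p \<in> \<Union>{l \<in> pencil. l \<inter> point_fibre \<epsilon> i \<noteq> {}} - {c\<^sub>0}"
      then obtain l q where l: "l \<in> pg_lines" "l \<subseteq> P" "c\<^sub>0 \<in> l" "p \<in> l" "q \<in> l" "\<epsilon> q = i" "p \<noteq> c\<^sub>0"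
        unfolding pencil_def point_fibre_def by auto
      then have "p \<in> pg_points" "\<epsilon> p \<noteq> c"
        using C unfolding P_def flat_def C_def point_fibre_def by auto
      then show "p \<in> point_fibre \<epsilon> i \<inter> P"
        using line_two_colours[OF l(1,5,3,4)] l c\<^sub>0 i unfolding point_fibre_def by auto
    qed
  qed
  have pencil_eq: "Ah \<union> Bh = {l \<in> pg_lines. l \<subseteq> P \<and> c\<^sub>0 \<in> l}"
    using covered unfolding Ah_def Bh_def pencil_def by blast
  have card_Ah: "card Ah \<ge> 2"
    unfolding Ah_def A_def using two_lines[of a b] neutral dist by simp
  have card_Bh: "card Bh \<ge> 2"
    unfolding Bh_def B_def using two_lines[of b a] neutral dist by (auto simp: insert_commute)
  have cones: "A \<inter> P = \<Union>Ah - {c\<^sub>0}" "B \<inter> P = \<Union>Bh - {c\<^sub>0}"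
    unfolding Ah_def Bh_def A_def B_def using cone[of a] cone[of b] dist by auto
  have "\<exists>Ah Bh. Ah \<union> Bh = {l \<in> pg_lines. l \<subseteq> P \<and> c\<^sub>0 \<in> l} \<and> Ah \<inter> Bh = {} \<and>
      card Ah \<ge> 2 \<and> card Bh \<ge> 2 \<and> A \<inter> P = \<Union>Ah - {c\<^sub>0} \<and> B \<inter> P = \<Union>Bh - {c\<^sub>0}"
    using pencil_eq disjoint card_Ah card_Bh cones by metis
  then have type_II: "type_II_plane A B C P"
    unfolding type_II_plane_def using P(1) P_colours C by auto
  have only_P: "P' = P" if P': "P' \<in> pg_planes" "U \<subseteq> P'" "c\<^sub>0 \<in> P'" for P'
  proof -
    obtain M where M: "vec.subspace M" "vec.dim M = 3" "P' = flat M"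
      using P'(1) unfolding pg_planes_eq by auto
    have "H \<subseteq> M"
      using P'(2) M sub unfolding U_def by (simp add: flat_subset_iff)
    moreover have "e c \<in> M"
      using P'(3) M unfolding c\<^sub>0_def by (simp add: span_singleton_in_flat)
    ultimately have "M = vec.span (e ` {a, b, c})"
      using M dim_N e_in unfolding N_def by (intro span_eqI) auto
    then show ?thesis
      unfolding M(3) P_def N_def by simp
  qed
  have other: "P' - U \<subseteq> D" if P': "P' \<in> pg_planes" "U \<subseteq> P'" "P' \<noteq> P" for P'
  proof
    fix p assume p: "p \<in> P' - U"
    obtain M where M: "vec.subspace M" "P' = flat M"
      using P'(1) unfolding pg_planes_eq by auto
    then obtain x where x: "x \<noteq> 0" "x \<in> M" "p = vec.span {x}"
      using p in_flat_cases by blast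
    have "x \<notin> N"
    proof
      assume "x \<in> N"
      then obtain s y where sy: "x = s *s e c + y" "y \<in> H"
        using split_N by blast
      have "s \<noteq> 0"
        using sy x p sub unfolding U_def by (auto simp: span_singleton_in_flat)
      have "y \<in> M"
        using sy(2) P'(2) M sub unfolding U_def by (auto simp: flat_subset_iff)
      then have "x - y \<in> M"
        using x M by (auto intro: vec.subspace_diff)
      then have "s *s e c \<in> M"
        using sy by simp
      then have "inverse s *s (s *s e c) \<in> M"
        by (rule vec.subspace_scale[OF M(1)])
      then have "c\<^sub>0 \<in> P'"
        using \<open>s \<noteq> 0\<close> M frame_nonzero unfolding c\<^sub>0_def by (simp add: span_singleton_in_flat)
      then show False
        using only_P P' by blast
    qed
    then show "p \<in> D"
      using colour_outside x unfolding D_def by (simp add: span_singleton_in_fibre)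
  qed
  have "\<exists>!P. P \<in> pg_planes \<and> U \<subseteq> P \<and> type_II_plane A B C P"
  proof (rule ex1I[of _ P])
    fix P' assume P': "P' \<in> pg_planes \<and> U \<subseteq> P' \<and> type_II_plane A B C P'"
    then have "c\<^sub>0 \<in> P'"
      unfolding type_II_plane_def C by auto
    then show "P' = P"
      using only_P P' by blast
  qed (use P type_II in auto)
  then show ?thesis
    using U other type_II by blast
qed

end

lemma bij_of_distinct:
  fixes a b c d :: 4
  assumes "distinct [a, b, c, d]"
  obtains \<pi> :: "4 \<Rightarrow> 4" where "bij \<pi>" "\<pi> 0 = a" "\<pi> 1 = b" "\<pi> 2 = c" "\<pi> 3 = d"
proof -
  define \<pi> :: "4 \<Rightarrow> 4" where
    "\<pi> = (\<lambda>i. if i = 0 then a else if i = 1 then b else if i = 2 then c else d)"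
  have "inj \<pi>"
    unfolding inj_def forall_4 \<pi>_def using assms by auto
  then have "bij \<pi>"
    by (simp add: bij_def finite_UNIV_inj_surj)
  then show ?thesis
    using that[of \<pi>] unfolding \<pi>_def by simp
qed

theorem theorem5p2:
  fixes \<epsilon>_pt :: "('k::{field,finite} ^ 4) set \<Rightarrow> 4"
    and \<epsilon>_ln :: "('k ^ 4) set set \<Rightarrow> 4 set"
  assumes "geometry_epimorphism pg_points pg_lines K4_points K4_lines \<epsilon>_pt \<epsilon>_ln"
  shows "\<exists>\<pi> :: 4 \<Rightarrow> 4. bij \<pi> \<and>
    (let A = point_fibre \<epsilon>_pt (\<pi> 0); B = point_fibre \<epsilon>_pt (\<pi> 1);
         C = point_fibre \<epsilon>_pt (\<pi> 2); D = point_fibre \<epsilon>_pt (\<pi> 3)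
     in \<exists>U\<in>pg_lines. card (U \<inter> A) \<ge> 1 \<and> card (U \<inter> B) \<ge> 1 \<and> U \<subseteq> A \<union> B \<and>
       (((\<exists>!P. P \<in> pg_planes \<and> U \<subseteq> P \<and> type_II_plane A B C P) \<and>
         (\<forall>P\<in>pg_planes. U \<subseteq> P \<and> \<not> type_II_plane A B C P \<longrightarrow> P - U \<subseteq> D))
        \<or>
        (\<exists>V\<in>pg_lines. card (C \<inter> V) \<ge> 1 \<and> card (D \<inter> V) \<ge> 1 \<and> C \<union> D = V \<and>
          (\<forall>u\<in>pg_points. u \<notin> U \<and> u \<notin> V \<longrightarrow>
            (\<exists>!W. W \<in> pg_lines \<and> u \<in> W \<and> W \<inter> U \<noteq> {} \<and> W \<inter> V \<noteq> {}) \<and>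
            (\<forall>W\<in>pg_lines. u \<in> W \<and> W \<inter> U \<noteq> {} \<and> W \<inter> V \<noteq> {} \<longrightarrow>
              ((\<exists>a\<in>A. W \<inter> U = {a}) \<longrightarrow> W - (W \<inter> V) \<subseteq> A) \<and>
              ((\<exists>b\<in>B. W \<inter> U = {b}) \<longrightarrow> W - (W \<inter> V) \<subseteq> B))))))"
proof -
  obtain e where "tetrahedron_frame \<epsilon>_pt e"
    using epimorphism_imp_frame[OF assms] .
  then interpret tetrahedron_frame \<epsilon>_pt e .
  show ?thesis
  proof (cases rule: four_vertex_tournament[of "0::4" 1 2 3 beats,
        case_names distinct asym triangle two_levels three_levels])
    case distinct
    show ?case by simp
  next
    case (asym i j)
    then show ?case by (rule not_beats_both)
  next
    case (triangle i j k)
    then show ?case by (rule rainbow_triangle)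
  next
    case (two_levels a b c d)
    obtain \<pi> :: "4 \<Rightarrow> 4" where \<pi>: "bij \<pi>" "\<pi> 0 = a" "\<pi> 1 = b" "\<pi> 2 = c" "\<pi> 3 = d"
      using bij_of_distinct[OF two_levels(1)] .
    show ?thesis
      unfolding Let_def
      by (rule exI[of _ \<pi>], unfold \<pi>(2-5), insert \<pi>(1) two_levels_structure[OF two_levels],
          elim bexE conjE, (intro bexI conjI disjI2; assumption))
  next
    case (three_levels a b c d)
    obtain \<pi> :: "4 \<Rightarrow> 4" where \<pi>: "bij \<pi>" "\<pi> 0 = a" "\<pi> 1 = b" "\<pi> 2 = c" "\<pi> 3 = d"
      using bij_of_distinct[OF three_levels(1)] .
    show ?thesis
      unfolding Let_def
      by (rule exI[of _ \<pi>], unfold \<pi>(2-5), insert \<pi>(1) three_levels_structure[OF three_levels],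
          elim bexE conjE, (intro bexI conjI disjI1; assumption))
  qed
qed

end
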